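(* Let $a<b$ be two real numbers and let $f:[a,b]\to\mathbb{R}$ be a function. (1) If $f$ admits a finite right-hand limit at each point of $[a,b)$ except on a Lebesgue-negligible set, then $f$ is continuous at each point of $[a,b]$ except on a Lebesgue-negligible set. (2) If $f$ admits a finite right-hand limit at each point of $[a,b)$ except on an at most countable set, then $f$ is continuous at each point of $[a,b]$ except on an at most countable set.
   Context: A subset $N\subset[a,b]$ is called Lebesgue-negligible when there exists a Borel subset $B$ of $[a,b]$ such that $N\subset B$ and $\mu(B)=0$, where $\mu$ is the Lebesgue measure on $\mathbb{R}$. The right-hand limit of $f$ at $x\in[a,b)$ is $f(x+):=\lim_{y\to x,\,y>x}f(y)$; the point $x$ itself is excluded, so the value $f(x)$ plays no role. *)

theory Defs
  imports "HOL-Analysis.Analysis"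
begin

definition lebesgue_negligible_in :: "real \<Rightarrow> real \<Rightarrow> real set \<Rightarrow> bool" where
  "lebesgue_negligible_in a b N \<longleftrightarrow>
     N \<subseteq> {a..b} \<and>
     (\<exists>B. B \<in> sets borel \<and> B \<subseteq> {a..b} \<and> N \<subseteq> B \<and> emeasure lborel B = 0)"

(* A function on [a,b] is represented by a total function on the reals. For x in [a,b)
   the filter at_right x excludes x itself and only depends on the values on (x,b). *)
definition has_finite_right_limit :: "(real \<Rightarrow> real) \<Rightarrow> real \<Rightarrow> bool" where
  "has_finite_right_limit f x \<longleftrightarrow> (\<exists>l::real. (f \<longlongrightarrow> l) (at_right x))"

end

(* At a point x with a finite right limit, every e > 0 admits an interval (x, x+d) on which f varies
   by less than e. Hence no point of (x, x+d) has oscillation at least e, so among the points with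
   a right limit those of oscillation at least e are isolated from the right, and there are
   only countably many of them. Letting e = 1/n shows that f has only countably many discontinuities
   outside the exceptional set. *)
theory Submission
  imports Defs
begin

text \<open>Each point of \<open>S\<close> has a gap of \<open>S\<close> directly to its right.
  Picking a rational in each gap gives a strictly increasing, hence injective, map from
  \<open>S\<close> into the countable set of rationals.\<close>

lemma countable_right_isolated:
  fixes S :: "real set"
  assumes "\<And>x. x \<in> S \<Longrightarrow> \<exists>d>0. {x<..<x+d} \<inter> S = {}"
  shows "countable S"
proof -
  have "\<forall>x\<in>S. \<exists>q\<in>\<rat>. x < q \<and> {x<..q} \<inter> S = {}"
  proof
    fix x assume "x \<in> S"
    then obtain d where d: "d > 0" "{x<..<x+d} \<inter> S = {}"
      using assms by blast
    then obtain q where "q \<in> \<rat>" "x < q" "q < x + d"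
      using Rats_dense_in_real[of x "x + d"] by auto
    moreover from this have "{x<..q} \<subseteq> {x<..<x+d}" by auto
    ultimately show "\<exists>q\<in>\<rat>. x < q \<and> {x<..q} \<inter> S = {}" using d by blast
  qed
  then obtain q where q: "\<forall>x\<in>S. q x \<in> \<rat> \<and> x < q x \<and> {x<..q x} \<inter> S = {}"
    by metis
  \<comment> \<open>Since \<open>y\<close> is a point of \<open>S\<close> to the right of
    \<open>x\<close>, it must lie beyond the gap, so \<open>q x < y < q y\<close>.\<close>
  have less: "q x < q y" if "x \<in> S" "y \<in> S" "x < y" for x y
  proof -
    have "y \<notin> {x<..q x}" using q that by blast
    with that q show ?thesis by fastforce
  qed
  have "inj_on q S"
    by (rule linorder_inj_onI') (use less in force)
  moreover have "countable (q ` S)"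
    using q by (intro countable_subset[OF _ countable_rat]) auto
  ultimately show ?thesis
    using countable_image_inj_on by blast
qed

text \<open>Just to the right of \<open>x\<close>, both values are within \<open>e / 2\<close> of
  the right limit.\<close>

lemma finite_right_limit_small_variation:
  assumes "has_finite_right_limit f x" "e > 0"
  shows "\<exists>d>0. \<forall>y\<in>{x<..<x+d}. \<forall>z\<in>{x<..<x+d}. dist (f y) (f z) < e"
proof -
  obtain l where "(f \<longlongrightarrow> l) (at_right x)"
    using assms by (auto simp: has_finite_right_limit_def)
  then have "\<forall>\<^sub>F y in at_right x. dist (f y) l < e / 2"
    using \<open>e > 0\<close> by (intro tendstoD) auto
  then obtain c where c: "c > x" "\<And>y. x < y \<Longrightarrow> y < c \<Longrightarrow> dist (f y) l < e / 2"
    by (auto simp: eventually_at_right_field)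
  have "dist (f y) (f z) < e" if "y \<in> {x<..<c}" "z \<in> {x<..<c}" for y z
    using that by (intro dist_triangle_half_l[OF c(2) c(2)]) auto
  with c(1) have "c - x > 0 \<and> (\<forall>y\<in>{x<..<x+(c-x)}. \<forall>z\<in>{x<..<x+(c-x)}. dist (f y) (f z) < e)"
    by simp
  then show ?thesis by (rule exI)
qed

lemma countable_discontinuities_with_right_limit:
  "countable {x. has_finite_right_limit f x \<and> \<not> isCont f x}"
proof -
  \<comment> \<open>Oscillation is measured against the value at the centre: \<open>D n\<close>
    collects the points with a right limit where the epsilon-delta condition fails for
    1/(n+1).\<close>
  define D where "D n = {x. has_finite_right_limit f x \<and>
      (\<forall>d>0. \<exists>y. dist y x < d \<and> \<not> dist (f y) (f x) < inverse (real (Suc n)))}" for n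
  have "countable (D n)" for n
  proof (rule countable_right_isolated)
    fix x assume "x \<in> D n"
    then obtain d where "d > 0" and d: "\<forall>y\<in>{x<..<x+d}. \<forall>z\<in>{x<..<x+d}.
        dist (f y) (f z) < inverse (real (Suc n))"
      using finite_right_limit_small_variation[of f x "inverse (real (Suc n))"]
      unfolding D_def by force
    \<comment> \<open>A small ball around \<open>z\<close> stays in the interval, so the bound on
      the right of \<open>x\<close> controls \<open>f\<close> on both sides of \<open>z\<close> and
      verifies the epsilon-delta condition there.\<close>
    have "z \<notin> D n" if z: "z \<in> {x<..<x+d}" for z
    proof -
      obtain r where "r > 0" "ball z r \<subseteq> {x<..<x+d}"
        using z by (meson openE open_greaterThanLessThan)
      then have "dist (f y) (f z) < inverse (real (Suc n))" if "dist y z < r" for y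
        using d z that by (metis dist_commute mem_ball subsetD)
      with \<open>r > 0\<close> show ?thesis unfolding D_def by blast
    qed
    with \<open>d > 0\<close> show "\<exists>d>0. {x<..<x+d} \<inter> D n = {}" by blast
  qed
  moreover have "{x. has_finite_right_limit f x \<and> \<not> isCont f x} \<subseteq> (\<Union>n. D n)"
  proof clarify
    fix x assume x: "has_finite_right_limit f x" "\<not> isCont f x"
    then obtain e where e: "e > 0" "\<forall>d>0. \<exists>y. dist y x < d \<and> \<not> dist (f y) (f x) < e"
      by (auto simp: continuous_at_eps_delta dist_real_def)
    obtain n where "inverse (real (Suc n)) < e"
      using reals_Archimedean[OF e(1)] by auto
    then have "\<forall>d>0. \<exists>y. dist y x < d \<and> \<not> dist (f y) (f x) < inverse (real (Suc n))"
      using e(2) by (meson less_trans)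
    with x have "x \<in> D n" unfolding D_def by blast
    then show "x \<in> (\<Union>n. D n)" by blast
  qed
  ultimately show ?thesis
    by (meson countable_UN countable_subset countableI_type)
qed

text \<open>A countable set is itself a Borel null set, so adjoining \<open>C\<close> to the Borel
  cover of \<open>N\<close> gives a cover of the union.\<close>

lemma lebesgue_negligible_in_Un_countable:
  assumes "lebesgue_negligible_in a b N" "countable C" "C \<subseteq> {a..b}"
  shows "lebesgue_negligible_in a b (N \<union> C)"
proof -
  obtain B where B: "B \<in> sets borel" "B \<subseteq> {a..b}" "N \<subseteq> B" "emeasure lborel B = 0"
    using assms by (auto simp: lebesgue_negligible_in_def)
  have "B \<union> C \<in> null_sets lborel"
    using B countable_imp_null_set_lborel[OF assms(2)] by (intro null_sets.Un) auto
  with B assms(3) show ?thesis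
    unfolding lebesgue_negligible_in_def by (intro conjI exI[of _ "B \<union> C"]) auto
qed

lemma lebesgue_negligible_in_subset:
  "lebesgue_negligible_in a b M \<Longrightarrow> N \<subseteq> M \<Longrightarrow> lebesgue_negligible_in a b N"
  unfolding lebesgue_negligible_in_def by blast

theorem theorem1p1:
  fixes a b :: real and f :: "real \<Rightarrow> real"
  assumes "a < b"
  shows "(lebesgue_negligible_in a b {x \<in> {a..<b}. \<not> has_finite_right_limit f x} \<longrightarrow>
          lebesgue_negligible_in a b {x \<in> {a..b}. \<not> continuous (at x within {a..b}) f}) \<and>
         (countable {x \<in> {a..<b}. \<not> has_finite_right_limit f x} \<longrightarrow>
          countable {x \<in> {a..b}. \<not> continuous (at x within {a..b}) f})"
proof -
  let ?N = "{x \<in> {a..<b}. \<not> has_finite_right_limit f x}"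
  let ?D = "{x \<in> {a..b}. \<not> continuous (at x within {a..b}) f}"
  \<comment> \<open>The endpoints are included outright: nothing is assumed about a right limit at
    \<open>b\<close>, and at both ends \<open>isCont\<close> also depends on values of
    \<open>f\<close> outside the interval.\<close>
  define C where "C = {a, b} \<union> ({x. has_finite_right_limit f x \<and> \<not> isCont f x} \<inter> {a..b})"
  have "countable C"
    unfolding C_def using countable_discontinuities_with_right_limit by blast
  have "C \<subseteq> {a..b}" using assms by (auto simp: C_def)
  \<comment> \<open>Two-sided continuity implies continuity within the interval, so a point of
    \<open>?D\<close> violates \<open>isCont\<close>; it is in \<open>C\<close> if it has a right
    limit or equals \<open>b\<close>, and in \<open>?N\<close> otherwise. Both claims follow from
    this inclusion.\<close>
  have D: "?D \<subseteq> ?N \<union> C"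
    using continuous_at_imp_continuous_at_within by (fastforce simp: C_def)
  show ?thesis
  proof (intro conjI impI)
    assume "lebesgue_negligible_in a b ?N"
    then have "lebesgue_negligible_in a b (?N \<union> C)"
      using \<open>countable C\<close> \<open>C \<subseteq> {a..b}\<close> by (rule lebesgue_negligible_in_Un_countable)
    then show "lebesgue_negligible_in a b ?D"
      using D by (rule lebesgue_negligible_in_subset)
  next
    assume "countable ?N"
    with \<open>countable C\<close> show "countable ?D"
      using countable_subset[OF D] by blast
  qed
qed

end
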